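(* Let $(X,\mathcal{A},\mu)$ be a measure space with non-trivial $\sigma$-finite measure $\mu$, and let $w\in W$ satisfy $\gamma(w)<\infty$. Then for every measurable function $f:X\to\mathbb{R}$ $$ 1\cdot\|f\|_w^*\ \le\ \|f\|_w\ \le\ \gamma(w)\cdot\|f\|_w^*, $$ and both the coefficients "$1$" and "$\gamma(w)$" in these inequalities are the best possible; that is, $1$ is the largest constant $c$ such that $c\,\|f\|_w^*\le\|f\|_w$ for all measurable $f$, and $\gamma(w)$ is the smallest constant $C$ such that $\|f\|_w\le C\,\|f\|_w^*$ for all measurable $f$.
   Context: For measurable $f:X\to\mathbb{R}$ the tail function is $T_f(t)=\mu\{x:|f(x)|\ge t\}$, $t\ge 0$. The function $f^*$ is the (left) inverse of the tail function, i.e. the decreasing rearrangement $f^*(t)=\inf\{s\ge 0: T_f(s)\le t\}$, and $f^{**}(t)=\frac1t\int_0^t f^*(s)\,ds$, $t>0$. The class $W$ of weights consists of all continuous strictly increasing functions $w:[0,\mu(X))\to[0,\infty)$ such that $w(s)=0\Leftrightarrow s=0$, $\lim_{s\to\mu(X)}w(s)=\infty$, and such that there exists a tail function $T$ (that is, $T=T_g$ for some measurable $g:X\to\mathbb{R}$) with $w(T(s))=1/s$ for all $s>0$. For $w\in W$ define (all suprema are over $0<t<\mu(X)$, the domain of the weight) $$ \gamma(w)=\sup_{t}\left[\frac{w(t)}{t}\int_0^t\frac{du}{w(u)}\right],\qquad \|f\|_w^*=\sup_{t}\,[w(t)f^*(t)],\qquad \|f\|_w=\sup_{t}\,[w(t)f^{**}(t)],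 $$ with values in $[0,\infty]$. *)

theory Defs
  imports "HOL-Analysis.Analysis"
begin

definition tail :: "'a measure \<Rightarrow> ('a \<Rightarrow> real) \<Rightarrow> real \<Rightarrow> ennreal" where
  "tail M f t = emeasure M {x \<in> space M. \<bar>f x\<bar> \<ge> t}"

(* The infimum is taken in [0, \<infinity>], with inf {} = \<infinity>: the tail of a real-valued f may stay above t
   forever when M is infinite. *)
definition rearr :: "'a measure \<Rightarrow> ('a \<Rightarrow> real) \<Rightarrow> real \<Rightarrow> ennreal" where
  "rearr M f t = Inf {ennreal s | s. s \<ge> 0 \<and> tail M f s \<le> ennreal t}"

definition max_rearr :: "'a measure \<Rightarrow> ('a \<Rightarrow> real) \<Rightarrow> real \<Rightarrow> ennreal" where
  "max_rearr M f t = ennreal (1 / t) * (\<integral>\<^sup>+ s\<in>{0<..<t}. rearr M f s \<partial>lborel)"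

(* The interval [0, \<mu>(X)), where \<mu>(X) may be infinite. *)
definition weight_dom :: "'a measure \<Rightarrow> real set" where
  "weight_dom M = {t. 0 \<le> t \<and> ennreal t < emeasure M (space M)}"

(* Weights are total functions on the reals; only their values on weight_dom M are ever used.
   In the last condition w (T s) only makes sense if T s lies in [0, \<mu>(X)), which is required
   explicitly because enn2real maps \<infinity> to 0. *)
definition weights :: "'a measure \<Rightarrow> (real \<Rightarrow> real) set" where
  "weights M = {w.
     continuous_on (weight_dom M) w \<and>
     strict_mono_on (weight_dom M) w \<and>
     (\<forall>s\<in>weight_dom M. w s \<ge> 0) \<and>
     (\<forall>s\<in>weight_dom M. w s = 0 \<longleftrightarrow> s = 0) \<and>
     filterlim w at_top
       (if emeasure M (space M) = \<infinity> then at_top else at_left (measure M (space M))) \<and>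
     (\<exists>g\<in>borel_measurable M. \<forall>s>0.
        tail M g s < emeasure M (space M) \<and> w (enn2real (tail M g s)) = 1 / s)}"

definition weight_gamma :: "'a measure \<Rightarrow> (real \<Rightarrow> real) \<Rightarrow> ennreal" where
  "weight_gamma M w =
     (SUP t\<in>weight_dom M - {0}. ennreal (w t / t) * (\<integral>\<^sup>+ u\<in>{0<..<t}. ennreal (1 / w u) \<partial>lborel))"

definition star_norm :: "'a measure \<Rightarrow> (real \<Rightarrow> real) \<Rightarrow> ('a \<Rightarrow> real) \<Rightarrow> ennreal" where
  "star_norm M w f = (SUP t\<in>weight_dom M - {0}. ennreal (w t) * rearr M f t)"

definition weak_norm :: "'a measure \<Rightarrow> (real \<Rightarrow> real) \<Rightarrow> ('a \<Rightarrow> real) \<Rightarrow> ennreal" where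
  "weak_norm M w f = (SUP t\<in>weight_dom M - {0}. ennreal (w t) * max_rearr M f t)"

end

theory Submission
  imports Defs
begin

text \<open>
  The left inequality holds because \<open>f\<^sup>*\<close> is decreasing, the right one because
  \<open>f\<^sup>* \<le> \<parallel>f\<parallel>\<^sub>w\<^sup>* / w\<close>. The function \<open>g\<close> from the definition of the class of weights has
  \<open>g\<^sup>* = 1 / w\<close>, hence attains the constant \<open>\<gamma>(w)\<close>.

  For the constant \<open>1\<close>, finiteness of \<open>\<gamma>(w)\<close> bounds \<open>w t / t\<close> on \<open>t \<ge> a\<close> for every \<open>a > 0\<close>, which excludes
  finite \<open>\<mu>(X)\<close>. Let \<open>K\<close> be the supremum of \<open>w t / t\<close> over \<open>t \<ge> 1\<close>. The indicator of a set of
  measure \<open>a > b \<ge> 1\<close> (a superlevel set of \<open>g\<close>) satisfies \<open>\<parallel>f\<parallel>\<^sub>w \<le> a K\<close> and \<open>w b \<le> \<parallel>f\<parallel>\<^sub>w\<^sup>*\<close>.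
  So \<open>c w b \<le> a K\<close> for all such \<open>a\<close> and \<open>b\<close>, and therefore \<open>c K \<le> K\<close>.
\<close>

section \<open>Monotonicity of rearrangements and of weights\<close>

lemma rearr_antimono:
  assumes "s \<le> t"
  shows "rearr M f t \<le> rearr M f s"
  unfolding rearr_def
  by (rule Inf_superset_mono) (use assms in \<open>fastforce intro: order_trans ennreal_leI\<close>)

text \<open>The average of a decreasing function over \<open>{0<..<t}\<close> is at least its value
  at the right end.\<close>

lemma rearr_le_max_rearr:
  assumes "t > 0"
  shows "rearr M f t \<le> max_rearr M f t"
proof -
  have "rearr M f t = ennreal (1 / t) * (\<integral>\<^sup>+ s\<in>{0<..<t}. rearr M f t \<partial>lborel)"
    using assms
    by (simp add: nn_integral_cmult_indicator mult.left_commute flip: ennreal_mult)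
  also have "\<dots> \<le> max_rearr M f t"
    unfolding max_rearr_def
    by (intro mult_left_mono nn_integral_mono)
      (auto simp: indicator_def intro: rearr_antimono)
  finally show ?thesis .
qed

lemma weight_dom_downward:
  assumes "t \<in> weight_dom M" "0 \<le> s" "s \<le> t"
  shows "s \<in> weight_dom M"
  using assms unfolding weight_dom_def by (auto intro: le_less_trans ennreal_leI)

lemma weight_nonneg:
  assumes "w \<in> weights M" "s \<in> weight_dom M"
  shows "0 \<le> w s"
  using assms unfolding weights_def by auto

lemma weight_pos:
  assumes "w \<in> weights M" "s \<in> weight_dom M" "0 < s"
  shows "0 < w s"
  using assms unfolding weights_def by (auto simp: less_le)

lemma weight_le_iff:
  assumes "w \<in> weights M" "s \<in> weight_dom M" "t \<in> weight_dom M"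
  shows "w s \<le> w t \<longleftrightarrow> s \<le> t"
proof -
  have "strict_mono_on (weight_dom M) w"
    using assms(1) unfolding weights_def by blast
  then show ?thesis
    using assms(2,3) by (rule strict_mono_on_less_eq)
qed

text \<open>Nothing is known about \<open>w\<close> outside \<open>weight_dom M\<close>, so the
  reciprocal is cut off to an open interval on which \<open>w\<close> is continuous and
  nonzero.\<close>

lemma borel_measurable_inverse_weight:
  assumes "w \<in> weights M" "t \<in> weight_dom M"
  shows "(\<lambda>u. ennreal (1 / w u) * indicator {0<..<t} u) \<in> borel_measurable lborel"
proof -
  have dom: "{0<..<t} \<subseteq> weight_dom M"
    using weight_dom_downward[OF assms(2)] by auto
  have "continuous_on (weight_dom M) w"
    using assms(1) unfolding weights_def by blast
  then have "continuous_on {0<..<t} w"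
    using dom continuous_on_subset by blast
  moreover have "\<forall>u\<in>{0<..<t}. w u \<noteq> 0"
  proof
    fix u assume "u \<in> {0<..<t}"
    then show "w u \<noteq> 0"
      using weight_pos[OF assms(1), of u] dom by auto
  qed
  ultimately have "continuous_on {0<..<t} (\<lambda>u. 1 / w u)"
    by (intro continuous_intros)
  then have "(\<lambda>u. indicator {0<..<t} u *\<^sub>R (1 / w u)) \<in> borel_measurable borel"
    by (intro borel_measurable_continuous_on_indicator) auto
  then have "(\<lambda>u. ennreal (indicator {0<..<t} u *\<^sub>R (1 / w u))) \<in> borel_measurable lborel"
    by simp
  also have "(\<lambda>u. ennreal (indicator {0<..<t} u *\<^sub>R (1 / w u)))
      = (\<lambda>u. ennreal (1 / w u) * indicator {0<..<t} u)"
    by (auto simp: indicator_def)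
  finally show ?thesis .
qed

section \<open>The two norm inequalities\<close>

lemma star_norm_le_weak_norm: "star_norm M w f \<le> weak_norm M w f"
  unfolding star_norm_def weak_norm_def
  by (rule SUP_mono) (fastforce intro!: mult_left_mono rearr_le_max_rearr
      simp: weight_dom_def less_le)

lemma weak_norm_le_gamma_star_norm:
  assumes w: "w \<in> weights M"
  shows "weak_norm M w f \<le> weight_gamma M w * star_norm M w f"
  unfolding weak_norm_def
proof (rule SUP_least)
  let ?S = "star_norm M w f"
  fix t assume t: "t \<in> weight_dom M - {0}"
  then have tpos: "0 < t" by (auto simp: weight_dom_def)
  have bound: "rearr M f u \<le> ?S * ennreal (1 / w u)" if u: "u \<in> {0<..<t}" for u
  proof -
    have ud: "u \<in> weight_dom M"
      using weight_dom_downward[of t M u] t u by auto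
    have wu: "0 < w u"
      using weight_pos[OF w ud] u by auto
    \<comment> \<open>Multiplying by this unit instead of dividing keeps the argument valid when
      \<open>rearr M f u\<close> is infinite.\<close>
    have "ennreal (w u) * ennreal (1 / w u) = 1"
      using wu by (simp flip: ennreal_mult)
    then have "rearr M f u = ennreal (w u) * rearr M f u * ennreal (1 / w u)"
      by (metis mult.assoc mult.commute mult_1)
    also have "\<dots> \<le> ?S * ennreal (1 / w u)"
      unfolding star_norm_def using ud u by (intro mult_right_mono SUP_upper) auto
    finally show ?thesis .
  qed
  have "(\<integral>\<^sup>+ u\<in>{0<..<t}. rearr M f u \<partial>lborel)
      \<le> (\<integral>\<^sup>+ u. ?S * (ennreal (1 / w u) * indicator {0<..<t} u) \<partial>lborel)"
    using bound by (intro nn_integral_mono) (auto simp: indicator_def)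
  also have "\<dots> = ?S * (\<integral>\<^sup>+ u\<in>{0<..<t}. ennreal (1 / w u) \<partial>lborel)"
    using t by (intro nn_integral_cmult borel_measurable_inverse_weight[OF w]) auto
  finally have "ennreal (w t) * max_rearr M f t
      \<le> ennreal (w t) * (ennreal (1 / t) * (?S * (\<integral>\<^sup>+ u\<in>{0<..<t}. ennreal (1 / w u) \<partial>lborel)))"
    unfolding max_rearr_def by (intro mult_left_mono) auto
  also have "\<dots> = ennreal (w t / t) * (\<integral>\<^sup>+ u\<in>{0<..<t}. ennreal (1 / w u) \<partial>lborel) * ?S"
  proof -
    have "ennreal (w t / t) = ennreal (w t) * ennreal (1 / t)"
      using weight_nonneg[OF w, of t] t tpos by (simp flip: ennreal_mult)
    then show ?thesis by (simp add: ac_simps)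
  qed
  also have "\<dots> \<le> weight_gamma M w * ?S"
    unfolding weight_gamma_def using t by (intro mult_right_mono SUP_upper) auto
  finally show "ennreal (w t) * max_rearr M f t \<le> weight_gamma M w * ?S" .
qed

section \<open>The extremal function and sharpness of \<open>weight_gamma\<close>\<close>

text \<open>Since \<open>w\<close> is strictly increasing and maps the tail at \<open>s\<close> to
  \<open>1 / s\<close>, the tail at \<open>s > 0\<close> is at most \<open>t\<close> exactly when
  \<open>1 / w t \<le> s\<close>, so the infimum in \<open>rearr\<close> runs over all levels from
  \<open>1 / w t\<close> on. The last conclusion supplies sets of every prescribed measure in the
  domain.\<close>

lemma weight_extremal:
  assumes w: "w \<in> weights M"
  obtains g where "g \<in> borel_measurable M"
    and "\<And>t. t \<in> weight_dom M \<Longrightarrow> 0 < t \<Longrightarrow> rearr M g t = ennreal (1 / w t)"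
    and "\<And>t. t \<in> weight_dom M \<Longrightarrow> 0 < t \<Longrightarrow> tail M g (1 / w t) = ennreal t"
proof -
  from w obtain g where g: "g \<in> borel_measurable M"
    and T: "\<And>s. s > 0 \<Longrightarrow> tail M g s < emeasure M (space M)"
    and wT: "\<And>s. s > 0 \<Longrightarrow> w (enn2real (tail M g s)) = 1 / s"
    unfolding weights_def by blast
  \<comment> \<open>A tail strictly below the total measure is finite, so \<open>enn2real\<close>
    loses nothing.\<close>
  have tail_dom: "enn2real (tail M g s) \<in> weight_dom M"
    and tail_eq: "ennreal (enn2real (tail M g s)) = tail M g s" if "s > 0" for s
  proof -
    show eq: "ennreal (enn2real (tail M g s)) = tail M g s"
      using T[OF that] by (intro ennreal_enn2real) (auto simp: less_top intro: less_le_trans)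
    show "enn2real (tail M g s) \<in> weight_dom M"
      using T[OF that] unfolding weight_dom_def by (simp add: eq)
  qed
  have tail_le: "tail M g s \<le> ennreal t \<longleftrightarrow> 1 / w t \<le> s"
    if t: "t \<in> weight_dom M" "0 < t" and s: "0 < s" for s t
  proof -
    have wt: "0 < w t"
      using weight_pos[OF w t] .
    have "tail M g s \<le> ennreal t \<longleftrightarrow> enn2real (tail M g s) \<le> t"
      using t tail_eq[OF s] by (metis ennreal_le_iff less_imp_le)
    also have "\<dots> \<longleftrightarrow> 1 / s \<le> w t"
      using weight_le_iff[OF w tail_dom[OF s] t(1)] wT[OF s] by simp
    also have "\<dots> \<longleftrightarrow> 1 / w t \<le> s"
      using wt s by (simp add: field_simps)
    finally show ?thesis .
  qed
  show thesis
  proof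
    show "g \<in> borel_measurable M" by (fact g)
  next
    fix t assume t: "t \<in> weight_dom M" "0 < t"
    have wt: "0 < w t"
      using weight_pos[OF w t] .
    \<comment> \<open>The equivalence \<open>tail_le\<close> covers only \<open>s > 0\<close>; the
      level 0 is excluded because its tail is the whole measure, which exceeds
      \<open>t\<close>.\<close>
    have "tail M g 0 = emeasure M (space M)"
      unfolding tail_def by simp
    then have not0: "\<not> tail M g 0 \<le> ennreal t"
      using t by (simp add: weight_dom_def)
    have "{ennreal s | s. s \<ge> 0 \<and> tail M g s \<le> ennreal t} = {ennreal s | s. 1 / w t \<le> s}"
    proof -
      have "s \<ge> 0 \<and> tail M g s \<le> ennreal t \<longleftrightarrow> 1 / w t \<le> s" for s
      proof (cases "s > 0")
        case True
        then show ?thesis using tail_le[OF t] by simp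
      next
        case False
        moreover have "0 < 1 / w t"
          using wt by simp
        ultimately show ?thesis
          using not0 by (metis less_le_trans less_le)
      qed
      then show ?thesis by simp
    qed
    then show "rearr M g t = ennreal (1 / w t)"
      unfolding rearr_def
      by (auto intro!: Inf_eqI ennreal_leI)
    have s: "0 < 1 / w t"
      using wt by simp
    have "w (enn2real (tail M g (1 / w t))) = w t"
      using wT[OF s] by simp
    then have "enn2real (tail M g (1 / w t)) = t"
      using weight_le_iff[OF w tail_dom[OF s] t(1)] weight_le_iff[OF w t(1) tail_dom[OF s]]
      by simp
    then show "tail M g (1 / w t) = ennreal t"
      using tail_eq[OF s] by simp
  qed
qed

text \<open>Test the inequality on the extremal \<open>g\<close>: each product
  \<open>w t * rearr M g t\<close> is 1, while \<open>w t * max_rearr M g t\<close> is the very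
  expression whose supremum is \<open>weight_gamma M w\<close>.\<close>

lemma weight_gamma_le:
  assumes w: "w \<in> weights M"
    and C: "\<forall>f\<in>borel_measurable M. weak_norm M w f \<le> C * star_norm M w f"
  shows "weight_gamma M w \<le> C"
proof -
  obtain g where g: "g \<in> borel_measurable M"
    and rearr: "\<And>t. t \<in> weight_dom M \<Longrightarrow> 0 < t \<Longrightarrow> rearr M g t = ennreal (1 / w t)"
    using weight_extremal[OF w] by metis
  have "star_norm M w g \<le> 1"
    unfolding star_norm_def
  proof (rule SUP_least)
    fix t assume "t \<in> weight_dom M - {0}"
    then have t: "t \<in> weight_dom M" "0 < t" by (auto simp: weight_dom_def)
    show "ennreal (w t) * rearr M g t \<le> 1"
      using weight_pos[OF w t] by (simp add: rearr[OF t] flip: ennreal_mult)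
  qed
  have "weight_gamma M w \<le> weak_norm M w g"
    unfolding weight_gamma_def weak_norm_def
  proof (rule SUP_mono)
    fix t assume t': "t \<in> weight_dom M - {0}"
    then have t: "t \<in> weight_dom M" "0 < t" by (auto simp: weight_dom_def)
    have "(\<integral>\<^sup>+ u\<in>{0<..<t}. rearr M g u \<partial>lborel)
        = (\<integral>\<^sup>+ u\<in>{0<..<t}. ennreal (1 / w u) \<partial>lborel)"
      using weight_dom_downward[OF t(1)]
      by (intro nn_integral_cong) (auto simp: indicator_def rearr)
    moreover have "ennreal (w t / t) = ennreal (w t) * ennreal (1 / t)"
      using weight_nonneg[OF w t(1)] t(2) by (simp flip: ennreal_mult)
    ultimately have "ennreal (w t / t) * (\<integral>\<^sup>+ u\<in>{0<..<t}. ennreal (1 / w u) \<partial>lborel)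
        = ennreal (w t) * max_rearr M g t"
      unfolding max_rearr_def by (simp add: ac_simps)
    then show "\<exists>s\<in>weight_dom M - {0}.
        ennreal (w t / t) * (\<integral>\<^sup>+ u\<in>{0<..<t}. ennreal (1 / w u) \<partial>lborel)
          \<le> ennreal (w s) * max_rearr M g s"
      using t' by (intro bexI[of _ t]) auto
  qed
  also have "\<dots> \<le> C * star_norm M w g"
    using C g by blast
  also have "\<dots> \<le> C * 1"
    using \<open>star_norm M w g \<le> 1\<close> by (rule mult_left_mono) simp
  finally show ?thesis by simp
qed

section \<open>Growth of weights with finite \<open>weight_gamma\<close>\<close>

text \<open>As \<open>1 / w\<close> decreases, its integral over \<open>{0<..<t}\<close> is at least
  its integral over \<open>{0<..<a}\<close>, hence at least \<open>a / w a\<close>. Inserting this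
  into the expression for \<open>weight_gamma\<close> at \<open>t\<close> and cancelling
  \<open>a / w a\<close> gives the bound, which is uniform in \<open>t\<close>.\<close>

lemma weight_div_le_gamma:
  assumes w: "w \<in> weights M" and t: "t \<in> weight_dom M" and a: "0 < a" "a \<le> t"
  shows "ennreal (w t / t) \<le> weight_gamma M w * ennreal (w a / a)"
proof -
  have ad: "a \<in> weight_dom M"
    using weight_dom_downward[OF t] a by simp
  have wa: "0 < w a"
    using weight_pos[OF w ad a(1)] .
  have "ennreal (a / w a) = (\<integral>\<^sup>+ u\<in>{0<..<a}. ennreal (1 / w a) \<partial>lborel)"
    using a wa by (simp add: nn_integral_cmult_indicator flip: ennreal_mult)
  also have "\<dots> \<le> (\<integral>\<^sup>+ u\<in>{0<..<t}. ennreal (1 / w u) \<partial>lborel)"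
  proof (intro nn_integral_mono)
    fix u :: real
    have "1 / w a \<le> 1 / w u" if u: "0 < u" "u < a"
    proof -
      have ud: "u \<in> weight_dom M"
        using weight_dom_downward[OF ad] u by simp
      show ?thesis
        using weight_le_iff[OF w ud ad] weight_pos[OF w ud] u
        by (intro divide_left_mono mult_pos_pos wa) auto
    qed
    then show "ennreal (1 / w a) * indicator {0<..<a} u
        \<le> ennreal (1 / w u) * indicator {0<..<t} u"
      using a by (auto simp: indicator_def intro: ennreal_leI)
  qed
  finally have "ennreal (w t / t) * ennreal (a / w a)
      \<le> ennreal (w t / t) * (\<integral>\<^sup>+ u\<in>{0<..<t}. ennreal (1 / w u) \<partial>lborel)"
    by (rule mult_left_mono) simp
  also have "\<dots> \<le> weight_gamma M w"
    unfolding weight_gamma_def using t a by (intro SUP_upper) auto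
  finally have "ennreal (w t / t) * ennreal (a / w a) * ennreal (w a / a)
      \<le> weight_gamma M w * ennreal (w a / a)"
    by (rule mult_right_mono) simp
  moreover have "ennreal (a / w a) * ennreal (w a / a) = 1"
    using a wa by (simp flip: ennreal_mult)
  ultimately show ?thesis
    by (simp add: mult.assoc)
qed

text \<open>If the total measure were a finite \<open>m\<close>, then \<open>w t\<close> would blow
  up as \<open>t\<close> tends to \<open>m\<close> while \<open>t\<close> stays bounded, against the
  uniform bound on \<open>w t / t\<close> for \<open>t\<close> beyond \<open>m / 2\<close>.\<close>

lemma emeasure_space_infinite:
  assumes w: "w \<in> weights M" and pos: "emeasure M (space M) > 0"
    and fin: "weight_gamma M w < \<infinity>"
  shows "emeasure M (space M) = \<infinity>"
proof (rule ccontr)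
  assume ne: "emeasure M (space M) \<noteq> \<infinity>"
  define m where "m = measure M (space M)"
  have em: "emeasure M (space M) = ennreal m"
    unfolding m_def using ne by (intro emeasure_eq_ennreal_measure) auto
  have m: "0 < m"
    using pos em by simp
  have dom: "t \<in> weight_dom M \<longleftrightarrow> 0 \<le> t \<and> t < m" for t
    unfolding weight_dom_def em by (auto simp: ennreal_less_iff)
  have "filterlim w at_top (if emeasure M (space M) = \<infinity> then at_top else at_left m)"
    using w unfolding weights_def m_def by blast
  then have lim: "filterlim w at_top (at_left m)"
    using ne by simp
  obtain B where B: "weight_gamma M w * ennreal (w (m / 2) / (m / 2)) = ennreal B" "0 \<le> B"
    using fin by (cases "weight_gamma M w * ennreal (w (m / 2) / (m / 2))")
      (auto simp: ennreal_mult_eq_top_iff)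
  \<comment> \<open>The threshold is \<open>B * m\<close> because \<open>w t \<le> B * t\<close>
    together with \<open>t < m\<close> contradicts it.\<close>
  have "eventually (\<lambda>t. B * m < w t) (at_left m)"
    using lim by (simp add: filterlim_at_top_dense)
  moreover have "eventually (\<lambda>t. t \<in> {m / 2<..<m}) (at_left m)"
    using m by (intro eventually_at_left_real) simp
  ultimately have "eventually (\<lambda>t. B * m < w t \<and> t \<in> {m / 2<..<m}) (at_left m)"
    by (rule eventually_conj)
  then obtain t where t: "B * m < w t" "m / 2 < t" "t < m"
    using eventually_happens'[OF trivial_limit_at_left_real] by auto
  have "ennreal (w t / t) \<le> ennreal B"
    using weight_div_le_gamma[OF w, of t "m / 2"] t m unfolding B(1) dom by simp
  then have "w t / t \<le> B"
    using B(2) by simp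
  then have "w t \<le> B * t"
    using t m by (simp add: divide_le_eq)
  also have "\<dots> \<le> B * m"
    using t B(2) by (intro mult_left_mono) auto
  finally show False
    using t by simp
qed

section \<open>Rearrangement of indicator functions\<close>

text \<open>At every level \<open>s \<le> 1\<close> the tail is at least the measure of
  \<open>A\<close>, which is above \<open>t\<close>, so only levels \<open>s > 1\<close> enter the
  infimum.\<close>

lemma rearr_indicator_ge:
  assumes A: "A \<in> sets M" and "ennreal t < emeasure M A"
  shows "1 \<le> rearr M (indicator A) t"
  unfolding rearr_def
proof (rule Inf_greatest)
  fix x assume "x \<in> {ennreal s | s. s \<ge> 0 \<and> tail M (indicator A) s \<le> ennreal t}"
  then obtain s where s: "x = ennreal s" "s \<ge> 0" "tail M (indicator A) s \<le> ennreal t"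
    by auto
  have "1 < s"
  proof (rule ccontr)
    assume "\<not> 1 < s"
    \<comment> \<open>Only an inclusion is claimed: for \<open>s = 0\<close> the superlevel set is
      the whole space.\<close>
    then have "A \<subseteq> {x \<in> space M. \<bar>indicator A x :: real\<bar> \<ge> s}"
      using sets.sets_into_space[OF A] by auto
    moreover have "{x \<in> space M. \<bar>indicator A x :: real\<bar> \<ge> s} \<in> sets M"
      using A by measurable
    ultimately have "emeasure M A \<le> tail M (indicator A) s"
      unfolding tail_def by (rule emeasure_mono)
    then show False
      using s(3) assms(2) by auto
  qed
  then show "1 \<le> x"
    using s(1) by simp
qed

text \<open>Tails are taken with a non-strict inequality, so level 1 itself may fail to be
  admissible; levels \<open>1 + e\<close> always are, their superlevel set being empty.\<close>

lemma rearr_indicator_le_1: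
  assumes "A \<in> sets M"
  shows "rearr M (indicator A) t \<le> 1"
proof (rule ennreal_le_epsilon)
  fix e :: real assume e: "0 < e"
  have "{x \<in> space M. \<bar>indicator A x :: real\<bar> \<ge> 1 + e} = {}"
    using e by (auto simp: indicator_def)
  then have "rearr M (indicator A) t \<le> ennreal (1 + e)"
    unfolding rearr_def tail_def using e
    by (intro Inf_lower CollectI exI[of _ "1 + e"]) (auto simp: indicator_def)
  then show "rearr M (indicator A) t \<le> 1 + ennreal e"
    using e by simp
qed

text \<open>Every level \<open>e > 0\<close> is admissible, whereas the tail at 0 is the measure of
  the whole space; hence the value 0 is reached only through a limit.\<close>

lemma rearr_indicator_eq_0:
  assumes A: "A \<in> sets M" and le: "emeasure M A \<le> ennreal t"
  shows "rearr M (indicator A) t = 0"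
proof -
  have "rearr M (indicator A) t \<le> 0"
  proof (rule ennreal_le_epsilon)
    fix e :: real assume e: "0 < e"
    have "tail M (indicator A) e \<le> emeasure M A"
      unfolding tail_def using e
      by (intro emeasure_mono A) (auto simp: indicator_def split: if_splits)
    then have "rearr M (indicator A) t \<le> ennreal e"
      unfolding rearr_def using e le by (intro Inf_lower) auto
    then show "rearr M (indicator A) t \<le> 0 + ennreal e"
      by simp
  qed
  then show ?thesis by simp
qed

text \<open>The rearrangement is at most 1 and vanishes from \<open>a\<close> on, so its integral
  over \<open>{0<..<t}\<close> is at most \<open>min t a\<close>.\<close>

lemma max_rearr_indicator_le:
  assumes A: "A \<in> sets M" and a: "emeasure M A = ennreal a" "0 \<le> a" and t: "0 < t"
  shows "max_rearr M (indicator A) t \<le> ennreal (min 1 (a / t))"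
proof -
  have "(\<integral>\<^sup>+ s\<in>{0<..<t}. rearr M (indicator A) s \<partial>lborel)
      \<le> (\<integral>\<^sup>+ s. indicator {0<..<min t a} s \<partial>lborel)"
  proof (intro nn_integral_mono)
    fix s :: real
    have "rearr M (indicator A) s = 0" if "a \<le> s"
      using that a by (intro rearr_indicator_eq_0 A) (simp add: ennreal_leI)
    then show "rearr M (indicator A) s * indicator {0<..<t} s \<le> indicator {0<..<min t a} s"
      using rearr_indicator_le_1[OF A, of s] by (auto simp: indicator_def)
  qed
  also have "\<dots> = ennreal (min t a)"
    using t a by simp
  finally have "max_rearr M (indicator A) t \<le> ennreal (1 / t) * ennreal (min t a)"
    unfolding max_rearr_def by (rule mult_left_mono) simp
  also have "\<dots> = ennreal (min 1 (a / t))"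
    using t a by (auto simp: min_def divide_simps simp flip: ennreal_mult)
  finally show ?thesis .
qed

section \<open>Sharpness of the constant 1\<close>

lemma lower_constant_le_1:
  assumes w: "w \<in> weights M" and pos: "emeasure M (space M) > 0"
    and fin: "weight_gamma M w < \<infinity>"
    and c: "\<forall>f\<in>borel_measurable M. c * star_norm M w f \<le> weak_norm M w f"
  shows "c \<le> 1"
proof -
  have inf: "emeasure M (space M) = \<infinity>"
    using emeasure_space_infinite[OF w pos fin] .
  then have dom: "t \<in> weight_dom M \<longleftrightarrow> 0 \<le> t" for t
    unfolding weight_dom_def by simp
  \<comment> \<open>The range starts at 1 because \<open>weight_div_le_gamma\<close> bounds
    \<open>w t / t\<close> only away from 0. That \<open>K\<close> is finite and positive allows it
    to be cancelled at the end.\<close>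
  define K where "K = (SUP t\<in>{1..}. ennreal (w t / t))"
  have K_ge: "ennreal (w t / t) \<le> K" if "1 \<le> t" for t
    unfolding K_def using that by (intro SUP_upper) simp
  have "K \<le> weight_gamma M w * ennreal (w 1 / 1)"
    unfolding K_def using weight_div_le_gamma[OF w, of _ 1] by (intro SUP_least) (simp add: dom)
  also have "\<dots> < \<infinity>"
    using fin by (simp add: ennreal_mult_less_top)
  finally have K_fin: "K < \<infinity>" .
  have "0 < ennreal (w 1 / 1)"
    using weight_pos[OF w, of 1] by (simp add: dom)
  then have K_pos: "0 < K"
    using K_ge[of 1] by (meson less_le_trans order_refl)
  \<comment> \<open>The inequality \<open>b < a\<close> must be strict: the rearrangement of the
    indicator is at least 1 at \<open>b < a\<close>, but vanishes at \<open>a\<close>.\<close>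
  have key: "c * ennreal (w b) \<le> ennreal a * K" if b: "1 \<le> b" and ab: "b < a" for a b
  proof -
    obtain g where g: "g \<in> borel_measurable M" "tail M g (1 / w a) = ennreal a"
      using weight_extremal[OF w] dom[of a] b ab by (metis less_le_trans less_imp_le zero_less_one)
    define A where "A = {x \<in> space M. \<bar>g x\<bar> \<ge> 1 / w a}"
    have A: "A \<in> sets M"
      unfolding A_def using g(1) by measurable
    have eA: "emeasure M A = ennreal a"
      using g(2) unfolding tail_def A_def .
    have "ennreal (w b) = ennreal (w b) * 1"
      by simp
    also have "\<dots> \<le> ennreal (w b) * rearr M (indicator A) b"
      using b ab by (intro mult_left_mono rearr_indicator_ge A) (auto simp: eA ennreal_lessI)
    also have "\<dots> \<le> star_norm M w (indicator A)"
      unfolding star_norm_def using b by (intro SUP_upper) (simp add: dom)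
    finally have "c * ennreal (w b) \<le> c * star_norm M w (indicator A)"
      by (rule mult_left_mono) simp
    also have "\<dots> \<le> weak_norm M w (indicator A)"
      using c A by (simp add: borel_measurable_indicator)
    also have "\<dots> \<le> ennreal a * K"
      unfolding weak_norm_def
    proof (rule SUP_least)
      fix t assume "t \<in> weight_dom M - {0}"
      then have t: "0 < t" by (simp add: dom)
      have wt: "0 \<le> w t"
        using weight_nonneg[OF w, of t] t by (simp add: dom)
      have "ennreal (w t) * max_rearr M (indicator A) t
          \<le> ennreal (w t) * ennreal (min 1 (a / t))"
        using b ab t by (intro mult_left_mono max_rearr_indicator_le A eA) auto
      also have "\<dots> = ennreal (w t * min 1 (a / t))"
        using wt b ab t by (subst ennreal_mult) auto
      \<comment> \<open>The maximum treats both ranges of \<open>t\<close> at once: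
        \<open>w t\<close> is at most \<open>w a\<close> for \<open>t \<le> a\<close>, and the
        factor is \<open>a / t\<close> beyond. Since \<open>max a t\<close> is at least 1, the
        quotient is bounded by \<open>K\<close>.\<close>
      also have "\<dots> \<le> ennreal (a * (w (max a t) / max a t))"
      proof (rule ennreal_leI)
        have "w t \<le> w (max a t)"
          using weight_le_iff[OF w, of t "max a t"] t by (simp add: dom)
        moreover have "min 1 (a / t) = a / max a t"
          using b ab t by (auto simp: min_def max_def divide_simps)
        ultimately show "w t * min 1 (a / t) \<le> a * (w (max a t) / max a t)"
          using b ab t by (simp add: divide_right_mono mult.commute mult_left_mono)
      qed
      also have "\<dots> = ennreal a * ennreal (w (max a t) / max a t)"
        using b ab t weight_nonneg[OF w, of "max a t"]
        by (intro ennreal_mult) (auto simp: dom intro!: divide_nonneg_nonneg)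
      also have "\<dots> \<le> ennreal a * K"
        using b ab by (intro mult_left_mono K_ge) auto
      finally show "ennreal (w t) * max_rearr M (indicator A) t \<le> ennreal a * K" .
    qed
    finally show ?thesis .
  qed
  have "c * K \<le> K"
  proof -
    have "c * ennreal (w b / b) \<le> K" if b: "1 \<le> b" for b
    proof -
      obtain k where k: "K = ennreal k" "0 \<le> k"
        using K_fin by (cases K) auto
      have "c * ennreal (w b) \<le> ennreal (b * k)"
      proof (rule ennreal_le_epsilon)
        fix e :: real assume e: "0 < e"
        \<comment> \<open>With this choice the excess \<open>(a - b) * k\<close> equals
          \<open>e * k / (k + 1)\<close>, which is below \<open>e\<close>; so \<open>a\<close> may
          be replaced by \<open>b\<close> in \<open>key\<close>.\<close>
        define a where "a = b + e / (k + 1)"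
        have "b < a"
          unfolding a_def using e k by simp
        then have "c * ennreal (w b) \<le> ennreal a * K"
          by (rule key[OF b])
        also have "\<dots> = ennreal (a * k)"
          using b k \<open>b < a\<close> by (simp add: ennreal_mult)
        also have "\<dots> \<le> ennreal (b * k + e)"
          unfolding a_def using e k by (intro ennreal_leI) (simp add: field_simps)
        also have "\<dots> = ennreal (b * k) + ennreal e"
          using b k e by (intro ennreal_plus) auto
        finally show "c * ennreal (w b) \<le> ennreal (b * k) + ennreal e" .
      qed
      \<comment> \<open>Dividing by \<open>b\<close> turns the left side into \<open>c\<close> times
        a member of the family defining \<open>K\<close>; the supremum over \<open>b\<close> then
        gives \<open>c * K \<le> K\<close>.\<close>
      then have "c * ennreal (w b) * ennreal (1 / b) \<le> ennreal (b * k) * ennreal (1 / b)"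
        by (rule mult_right_mono) simp
      then show ?thesis
        using b k weight_nonneg[OF w, of b]
        by (simp add: dom mult.assoc flip: ennreal_mult)
    qed
    then show ?thesis
      unfolding K_def by (subst SUP_mult_left_ennreal) (auto intro: SUP_least)
  qed
  then have "K * c \<le> K * 1"
    by (simp add: mult.commute)
  then show ?thesis
    using K_fin K_pos by (subst (asm) ennreal_mult_le_mult_iff) auto
qed

theorem theorem2p1:
  fixes M :: "'a measure" and w :: "real \<Rightarrow> real"
  assumes "sigma_finite_measure M"
    and "emeasure M (space M) > 0"
    and "w \<in> weights M"
    and "weight_gamma M w < \<infinity>"
  shows "(\<forall>f\<in>borel_measurable M.
            1 * star_norm M w f \<le> weak_norm M w f \<and>
            weak_norm M w f \<le> weight_gamma M w * star_norm M w f) \<and>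
         (\<forall>c::ennreal. (\<forall>f\<in>borel_measurable M. c * star_norm M w f \<le> weak_norm M w f)
            \<longrightarrow> c \<le> 1) \<and>
         (\<forall>C::ennreal. (\<forall>f\<in>borel_measurable M. weak_norm M w f \<le> C * star_norm M w f)
            \<longrightarrow> weight_gamma M w \<le> C)"
  using star_norm_le_weak_norm[of M w] weak_norm_le_gamma_star_norm[OF assms(3)]
    lower_constant_le_1[OF assms(3,2,4)] weight_gamma_le[OF assms(3)]
  by simp

end
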